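(* Let $(X,\|\cdot\|)$ be a Banach space, $J:X\to X$ a nonexpansive mapping and $A=I-J$. Let $x_0,\hat x_0\in X$, let $\{\lambda_n\}_{n\ge1}$ and $\{\hat\lambda_n\}_{n\ge1}$ be two sequences in $(0,1]$, and let $(x_n)$, $(\hat x_n)$ be the Eulerian schemes defined for $n\ge 1$ by $x_n=x_{n-1}-\lambda_nA(x_{n-1})$ and $\hat x_n=\hat x_{n-1}-\hat\lambda_nA(\hat x_{n-1})$. Put $\sigma_n=\sum_{i=1}^n\lambda_i$, $\tau_n=\sum_{i=1}^n\lambda_i^2$, $\hat\sigma_n=\sum_{i=1}^n\hat\lambda_i$, $\hat\tau_n=\sum_{i=1}^n\hat\lambda_i^2$. Then for any $z\in X$ and any $(k,l)\in\mathbb N^2$, $$\|x_k-\hat x_l\|\leq\|x_0-z\|+\|\hat x_0-z\|+\|A(z)\|\sqrt{(\sigma_k-\hat\sigma_l)^2+\tau_k+\hat\tau_l}.$$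
   Context: $J$ nonexpansive means $\|J(x)-J(y)\|\le\|x-y\|$ for all $x,y\in X$. $I$ is the identity of $X$. $\mathbb N$ includes $0$, with $\sigma_0=\tau_0=\hat\sigma_0=\hat\tau_0=0$ (empty sums). *)

theory Defs
  imports "HOL-Analysis.Analysis"
begin

end

theory Submission
  imports Defs
begin

text \<open>
  Write the schemes as averages, \<open>x\<^sub>k = (1 - \<alpha>) x\<^sub>k\<^sub>-\<^sub>1 + \<alpha> J x\<^sub>k\<^sub>-\<^sub>1\<close> and
  \<open>x'\<^sub>l = (1 - \<beta>) x'\<^sub>l\<^sub>-\<^sub>1 + \<beta> J x'\<^sub>l\<^sub>-\<^sub>1\<close> with \<open>\<alpha> = \<lambda>\<^sub>k\<close> and \<open>\<beta> = \<lambda>'\<^sub>l\<close>. For suitable nonnegative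
  weights \<open>a + b + d = 1\<close> one has the identity
  \<open>x\<^sub>k - x'\<^sub>l = a (x\<^sub>k - x'\<^sub>l\<^sub>-\<^sub>1) + b (x\<^sub>k\<^sub>-\<^sub>1 - x'\<^sub>l) + d (J x\<^sub>k\<^sub>-\<^sub>1 - J x'\<^sub>l\<^sub>-\<^sub>1)\<close>, so nonexpansiveness
  bounds the distance at \<open>(k, l)\<close> by the same convex combination of the distances at \<open>(k, l-1)\<close>,
  \<open>(k-1, l)\<close> and \<open>(k-1, l-1)\<close> (\<open>averaged_step_distance\<close>).

  It remains to see that the right-hand side is a supersolution of this recursion. By concavity of
  the square root (\<open>sqrt_jensen3\<close>) it suffices that \<open>(\<sigma>\<^sub>k - \<sigma>'\<^sub>l)\<^sup>2 + \<tau>\<^sub>k + \<tau>'\<^sub>l\<close> is one, which is an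
  elementary inequality between polynomials (\<open>kobayashi_weights\<close>). On the boundary \<open>l = 0\<close> (or
  \<open>k = 0\<close>), the bound follows from \<open>\<parallel>x\<^sub>k - z\<parallel> \<le> \<parallel>x\<^sub>0 - z\<parallel> + \<sigma>\<^sub>k \<parallel>z - J z\<parallel>\<close>
  (\<open>averaged_scheme_dist_point\<close>).
\<close>

lemma sqrt_jensen3:
  fixes a b d p q r :: real
  assumes "a \<ge> 0" "b \<ge> 0" "d \<ge> 0" "a + b + d = 1" "p \<ge> 0" "q \<ge> 0" "r \<ge> 0"
  shows "a * sqrt p + b * sqrt q + d * sqrt r \<le> sqrt (a * p + b * q + d * r)"
proof (rule real_le_rsqrt)
  have jensen: "(a * s + b * t + d * u)\<^sup>2 \<le> a * s\<^sup>2 + b * t\<^sup>2 + d * u\<^sup>2" for s t u :: real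
  proof -
    have d: "d = 1 - a - b" using assms by simp
    have "a * s\<^sup>2 + b * t\<^sup>2 + d * u\<^sup>2 - (a * s + b * t + d * u)\<^sup>2
        = a * b * (s - t)\<^sup>2 + a * d * (s - u)\<^sup>2 + b * d * (t - u)\<^sup>2"
      unfolding d by algebra
    moreover have "\<dots> \<ge> 0" using assms by simp
    ultimately show ?thesis by linarith
  qed
  show "(a * sqrt p + b * sqrt q + d * sqrt r)\<^sup>2 \<le> a * p + b * q + d * r"
    using jensen[of "sqrt p" "sqrt q" "sqrt r"] assms by simp
qed

text \<open>
  The weights of the recursion. The three equations are what the vector identity in
  \<open>averaged_step_distance\<close> needs. In the inequality, \<open>s\<close> stands for
  \<open>\<sigma>\<^sub>k\<^sub>-\<^sub>1 - \<sigma>'\<^sub>l\<^sub>-\<^sub>1\<close> and \<open>T\<close> for \<open>\<tau>\<^sub>k\<^sub>-\<^sub>1 + \<tau>'\<^sub>l\<^sub>-\<^sub>1\<close>; the terms in \<open>T\<close>, \<open>s\<^sup>2\<close> and \<open>s\<close> agree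
  on both sides.
\<close>

lemma kobayashi_weights:
  fixes \<alpha> \<beta> :: real
  assumes "\<alpha> \<in> {0<..1}" "\<beta> \<in> {0<..1}"
  obtains a b d where "a \<ge> 0" "b \<ge> 0" "d \<ge> 0" "a + b + d = 1"
    "d = \<alpha> * (1 - a)" "d = \<beta> * (1 - b)"
    "\<And>s T. a * ((s + \<alpha>)\<^sup>2 + (T + \<alpha>\<^sup>2)) + b * ((s - \<beta>)\<^sup>2 + (T + \<beta>\<^sup>2)) + d * (s\<^sup>2 + T)
       \<le> (s + \<alpha> - \<beta>)\<^sup>2 + (T + \<alpha>\<^sup>2 + \<beta>\<^sup>2)"
proof -
  \<comment> \<open>The weights below are the unique solution of the three linear equations.\<close>
  define D where "D = \<alpha> + \<beta> - \<alpha> * \<beta>"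
  have "\<beta> * (1 - \<alpha>) \<ge> 0" using assms by simp
  moreover have "D = \<alpha> + \<beta> * (1 - \<alpha>)" by (simp add: D_def algebra_simps)
  moreover have "\<alpha> > 0" using assms by simp
  ultimately have D: "D > 0" by linarith
  define a where "a = \<alpha> * (1 - \<beta>) / D"
  define b where "b = \<beta> * (1 - \<alpha>) / D"
  define d where "d = \<alpha> * \<beta> / D"
  have aD: "a * D = \<alpha> * (1 - \<beta>)" and bD: "b * D = \<beta> * (1 - \<alpha>)" and dD: "d * D = \<alpha> * \<beta>"
    using D by (simp_all add: a_def b_def d_def)
  have sum: "a + b + d = 1"
  proof -
    have "(a + b + d) * D = 1 * D" unfolding distrib_right aD bD dD by (simp add: D_def algebra_simps)
    then show ?thesis using D by simp
  qed
  have da: "d = \<alpha> * (1 - a)"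
  proof -
    have "\<alpha> * (1 - a) * D = \<alpha> * (D - a * D)" by (simp add: algebra_simps)
    also have "\<dots> = d * D" unfolding aD dD by (simp add: D_def algebra_simps)
    finally show ?thesis using D by simp
  qed
  have db: "d = \<beta> * (1 - b)"
  proof -
    have "\<beta> * (1 - b) * D = \<beta> * (D - b * D)" by (simp add: algebra_simps)
    also have "\<dots> = d * D" unfolding bD dD by (simp add: D_def algebra_simps)
    finally show ?thesis using D by simp
  qed
  have linear: "a * \<alpha> - b * \<beta> = \<alpha> - \<beta>"
    using da db by (simp add: algebra_simps)
  have quadratic: "a * \<alpha>\<^sup>2 + b * \<beta>\<^sup>2 \<le> \<alpha>\<^sup>2 + \<beta>\<^sup>2 - \<alpha> * \<beta>"
  proof -
    have "(a * \<alpha>\<^sup>2 + b * \<beta>\<^sup>2) * D = (a * D) * \<alpha>\<^sup>2 + (b * D) * \<beta>\<^sup>2"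
      by (simp add: algebra_simps)
    also have "\<dots> = (\<alpha>\<^sup>2 + \<beta>\<^sup>2 - \<alpha> * \<beta>) * D - (\<alpha> * \<beta>)\<^sup>2"
      unfolding aD bD by (simp add: D_def algebra_simps power2_eq_square)
    also have "\<dots> \<le> (\<alpha>\<^sup>2 + \<beta>\<^sup>2 - \<alpha> * \<beta>) * D" by simp
    finally show ?thesis using D by simp
  qed
  show thesis
  proof (rule that)
    show "a \<ge> 0" "b \<ge> 0" "d \<ge> 0" using assms D by (simp_all add: a_def b_def d_def)
    show "a * ((s + \<alpha>)\<^sup>2 + (T + \<alpha>\<^sup>2)) + b * ((s - \<beta>)\<^sup>2 + (T + \<beta>\<^sup>2)) + d * (s\<^sup>2 + T)
       \<le> (s + \<alpha> - \<beta>)\<^sup>2 + (T + \<alpha>\<^sup>2 + \<beta>\<^sup>2)" for s T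
    proof -
      have "a * ((s + \<alpha>)\<^sup>2 + (T + \<alpha>\<^sup>2)) + b * ((s - \<beta>)\<^sup>2 + (T + \<beta>\<^sup>2)) + d * (s\<^sup>2 + T)
        = (a + b + d) * (s\<^sup>2 + T) + 2 * s * (a * \<alpha> - b * \<beta>) + 2 * (a * \<alpha>\<^sup>2 + b * \<beta>\<^sup>2)"
        by algebra
      also have "\<dots> \<le> (s\<^sup>2 + T) + 2 * s * (\<alpha> - \<beta>) + 2 * (\<alpha>\<^sup>2 + \<beta>\<^sup>2 - \<alpha> * \<beta>)"
        unfolding sum linear using quadratic by simp
      also have "\<dots> = (s + \<alpha> - \<beta>)\<^sup>2 + (T + \<alpha>\<^sup>2 + \<beta>\<^sup>2)" by algebra
      finally show ?thesis .
    qed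
  qed (use sum da db in auto)
qed

lemma averaged_step_distance:
  fixes J :: "'a::real_normed_vector \<Rightarrow> 'a"
  assumes nonexpansive: "norm (J u - J v) \<le> norm (u - v)"
    and u': "u' = u - \<alpha> *\<^sub>R (u - J u)" and v': "v' = v - \<beta> *\<^sub>R (v - J v)"
    and "a \<ge> 0" "b \<ge> 0" "d \<ge> 0"
    and sum: "a + b + d = 1" and da: "d = \<alpha> * (1 - a)" and db: "d = \<beta> * (1 - b)"
  shows "norm (u' - v') \<le> a * norm (u' - v) + b * norm (u - v') + d * norm (u - v)"
proof -
  have a: "1 - a = b + d" and b: "1 - b = a + d" using sum by auto
  have "(1 - a) *\<^sub>R u' = (1 - a) *\<^sub>R u - d *\<^sub>R (u - J u)"
    unfolding u' da by (simp add: scaleR_diff_right mult.commute)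
  also have "\<dots> = b *\<^sub>R u + d *\<^sub>R J u" unfolding a by (simp add: algebra_simps)
  finally have 1: "(1 - a) *\<^sub>R u' = b *\<^sub>R u + d *\<^sub>R J u" .
  have "(1 - b) *\<^sub>R v' = (1 - b) *\<^sub>R v - d *\<^sub>R (v - J v)"
    unfolding v' db by (simp add: scaleR_diff_right mult.commute)
  also have "\<dots> = a *\<^sub>R v + d *\<^sub>R J v" unfolding b by (simp add: algebra_simps)
  finally have 2: "(1 - b) *\<^sub>R v' = a *\<^sub>R v + d *\<^sub>R J v" .
  from 1 2 have eqs: "a *\<^sub>R u' + (b *\<^sub>R u + d *\<^sub>R J u) = u'" "b *\<^sub>R v' + (a *\<^sub>R v + d *\<^sub>R J v) = v'"
    by (simp_all add: scaleR_diff_left diff_eq_eq add.commute)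
  have "a *\<^sub>R (u' - v) + b *\<^sub>R (u - v') + d *\<^sub>R (J u - J v)
      = (a *\<^sub>R u' + (b *\<^sub>R u + d *\<^sub>R J u)) - (b *\<^sub>R v' + (a *\<^sub>R v + d *\<^sub>R J v))"
    by (simp add: algebra_simps)
  then have "u' - v' = a *\<^sub>R (u' - v) + b *\<^sub>R (u - v') + d *\<^sub>R (J u - J v)"
    unfolding eqs by simp
  then have "norm (u' - v') \<le> norm (a *\<^sub>R (u' - v)) + norm (b *\<^sub>R (u - v')) + norm (d *\<^sub>R (J u - J v))"
    by (metis norm_triangle_ineq norm_triangle_le add_mono order_refl)
  also have "\<dots> = a * norm (u' - v) + b * norm (u - v') + d * norm (J u - J v)"
    using assms by simp
  also have "\<dots> \<le> a * norm (u' - v) + b * norm (u - v') + d * norm (u - v)"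
    using nonexpansive \<open>d \<ge> 0\<close> by (simp add: mult_left_mono)
  finally show ?thesis .
qed

lemma averaged_scheme_dist_point:
  fixes J :: "'a::real_normed_vector \<Rightarrow> 'a"
  assumes nonexpansive: "\<And>u v. norm (J u - J v) \<le> norm (u - v)"
    and lam: "\<And>n. lam (Suc n) \<in> {0<..1}"
    and x: "\<And>n. x (Suc n) = x n - lam (Suc n) *\<^sub>R (x n - J (x n))"
  shows "norm (x k - z) \<le> norm (x 0 - z) + norm (z - J z) * (\<Sum>i=1..k. lam i)"
proof (induction k)
  case (Suc k)
  define \<alpha> where "\<alpha> = lam (Suc k)"
  have \<alpha>: "0 \<le> \<alpha>" "\<alpha> \<le> 1" using lam[of k] by (auto simp: \<alpha>_def)
  have "x (Suc k) - z = (1 - \<alpha>) *\<^sub>R (x k - z) + \<alpha> *\<^sub>R (J (x k) - J z) - \<alpha> *\<^sub>R (z - J z)"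
    unfolding x \<alpha>_def by (simp add: algebra_simps)
  also have "norm \<dots> \<le> norm ((1 - \<alpha>) *\<^sub>R (x k - z)) + norm (\<alpha> *\<^sub>R (J (x k) - J z))
      + norm (\<alpha> *\<^sub>R (z - J z))"
    by (intro order_trans[OF norm_triangle_ineq4] add_right_mono norm_triangle_ineq)
  also have "\<dots> = (1 - \<alpha>) * norm (x k - z) + \<alpha> * norm (J (x k) - J z) + \<alpha> * norm (z - J z)"
    using \<alpha> by simp
  also have "\<dots> \<le> (1 - \<alpha>) * norm (x k - z) + \<alpha> * norm (x k - z) + \<alpha> * norm (z - J z)"
    using nonexpansive \<alpha> by (simp add: mult_left_mono)
  also have "\<dots> = norm (x k - z) + norm (z - J z) * \<alpha>" by (simp add: algebra_simps)
  finally show ?case using Suc by (simp add: \<alpha>_def distrib_left)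
qed simp

theorem proposition3p11:
  fixes J A :: "'a::banach \<Rightarrow> 'a"
    and x x' :: "nat \<Rightarrow> 'a"
    and lam lam' \<sigma> \<sigma>' \<tau> \<tau>' :: "nat \<Rightarrow> real"
    and z :: 'a
    and k l :: nat
  assumes nonexpansive: "\<And>u v. norm (J u - J v) \<le> norm (u - v)"
    and A: "\<And>u. A u = u - J u"
    and lam: "\<And>n. n \<ge> 1 \<Longrightarrow> lam n \<in> {0<..1}"
    and lam': "\<And>n. n \<ge> 1 \<Longrightarrow> lam' n \<in> {0<..1}"
    and x: "\<And>n. n \<ge> 1 \<Longrightarrow> x n = x (n - 1) - lam n *\<^sub>R A (x (n - 1))"
    and x': "\<And>n. n \<ge> 1 \<Longrightarrow> x' n = x' (n - 1) - lam' n *\<^sub>R A (x' (n - 1))"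
    and \<sigma>: "\<And>n. \<sigma> n = (\<Sum>i=1..n. lam i)"
    and \<tau>: "\<And>n. \<tau> n = (\<Sum>i=1..n. (lam i)\<^sup>2)"
    and \<sigma>': "\<And>n. \<sigma>' n = (\<Sum>i=1..n. lam' i)"
    and \<tau>': "\<And>n. \<tau>' n = (\<Sum>i=1..n. (lam' i)\<^sup>2)"
  shows "norm (x k - x' l) \<le> norm (x 0 - z) + norm (x' 0 - z)
           + norm (A z) * sqrt ((\<sigma> k - \<sigma>' l)\<^sup>2 + \<tau> k + \<tau>' l)"
proof -
  have A_eq: "A = (\<lambda>u. u - J u)" using A by auto
  have xS: "x (Suc n) = x n - lam (Suc n) *\<^sub>R (x n - J (x n))" for n
    using x[of "Suc n"] by (simp add: A_eq)
  have x'S: "x' (Suc n) = x' n - lam' (Suc n) *\<^sub>R (x' n - J (x' n))" for n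
    using x'[of "Suc n"] by (simp add: A_eq)
  have lamS: "lam (Suc n) \<in> {0<..1}" and lam'S: "lam' (Suc n) \<in> {0<..1}" for n
    using lam lam' by simp_all
  define C where "C = norm (x 0 - z) + norm (x' 0 - z)"
  define W where "W k l = (\<sigma> k - \<sigma>' l)\<^sup>2 + (\<tau> k + \<tau>' l)" for k l
  have \<tau>_nonneg: "\<tau> n \<ge> 0" and \<tau>'_nonneg: "\<tau>' n \<ge> 0" for n
    unfolding \<tau> \<tau>' by (simp_all add: sum_nonneg)
  have W_nonneg: "W k l \<ge> 0" for k l
    using \<tau>_nonneg \<tau>'_nonneg by (simp add: W_def)
  have "norm (x k - x' l) \<le> C + norm (A z) * sqrt (W k l)"
  proof (induction "k + l" arbitrary: k l rule: less_induct)
    case less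
    consider (left) "k = 0" | (right) "l = 0" | (step) m n where "k = Suc m" "l = Suc n"
      by (metis not0_implies_Suc)
    then show ?case
    proof cases
      case left
      have "norm (x k - x' l) \<le> norm (x 0 - z) + norm (x' l - z)"
        using norm_triangle_ineq4[of "x 0 - z" "x' l - z"] left by simp
      also have "norm (x' l - z) \<le> norm (x' 0 - z) + norm (A z) * \<sigma>' l"
        using averaged_scheme_dist_point[of J lam' x', OF nonexpansive lam'S x'S]
        by (simp add: A_eq \<sigma>')
      also have "\<sigma>' l \<le> sqrt (W k l)"
        using \<tau>_nonneg[of k] \<tau>'_nonneg[of l] by (intro real_le_rsqrt) (simp add: W_def left \<sigma>)
      finally show ?thesis by (simp add: C_def mult_left_mono)
    next
      case right
      have "norm (x k - x' l) \<le> norm (x k - z) + norm (x' 0 - z)"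
        using norm_triangle_ineq4[of "x k - z" "x' 0 - z"] right by simp
      also have "norm (x k - z) \<le> norm (x 0 - z) + norm (A z) * \<sigma> k"
        using averaged_scheme_dist_point[of J lam x, OF nonexpansive lamS xS]
        by (simp add: A_eq \<sigma>)
      also have "\<sigma> k \<le> sqrt (W k l)"
        using \<tau>_nonneg[of k] \<tau>'_nonneg[of l] by (intro real_le_rsqrt) (simp add: W_def right \<sigma>')
      finally show ?thesis by (simp add: C_def mult_left_mono)
    next
      case step
      obtain a b d where w: "a \<ge> 0" "b \<ge> 0" "d \<ge> 0" "a + b + d = 1"
          "d = lam k * (1 - a)" "d = lam' l * (1 - b)"
        and ineq: "\<And>s T. a * ((s + lam k)\<^sup>2 + (T + (lam k)\<^sup>2))
            + b * ((s - lam' l)\<^sup>2 + (T + (lam' l)\<^sup>2)) + d * (s\<^sup>2 + T)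
          \<le> (s + lam k - lam' l)\<^sup>2 + (T + (lam k)\<^sup>2 + (lam' l)\<^sup>2)"
        using kobayashi_weights lamS[of m] lam'S[of n] unfolding step by metis
      have W: "a * W k n + b * W m l + d * W m n \<le> W k l"
        using ineq[of "\<sigma> m - \<sigma>' n" "\<tau> m + \<tau>' n"]
        by (simp add: W_def step \<sigma> \<sigma>' \<tau> \<tau>' algebra_simps)
      have "norm (x k - x' l)
          \<le> a * norm (x k - x' n) + b * norm (x m - x' l) + d * norm (x m - x' n)"
        using averaged_step_distance[OF nonexpansive xS[of m] x'S[of n] w(1-4)] w(5,6)
        by (simp add: step)
      also have "\<dots> \<le> a * (C + norm (A z) * sqrt (W k n)) + b * (C + norm (A z) * sqrt (W m l))
          + d * (C + norm (A z) * sqrt (W m n))"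
        using w by (intro add_mono mult_left_mono less.hyps) (simp_all add: step)
      also have "\<dots> = (a + b + d) * C
          + norm (A z) * (a * sqrt (W k n) + b * sqrt (W m l) + d * sqrt (W m n))"
        by (simp add: algebra_simps)
      also have "\<dots> \<le> (a + b + d) * C + norm (A z) * sqrt (a * W k n + b * W m l + d * W m n)"
        using sqrt_jensen3[OF w(1-4) W_nonneg W_nonneg W_nonneg]
        by (intro add_left_mono mult_left_mono) auto
      also have "\<dots> \<le> C + norm (A z) * sqrt (W k l)"
        using W w(4) by (simp add: mult_left_mono)
      finally show ?thesis .
    qed
  qed
  then show ?thesis by (simp add: C_def W_def add.assoc)
qed

end
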